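(* Let $R$ be a commutative ring with identity. (a) $R$ is a $\tau_z^{\Delta}$-BFR if and only if $\omega(\Gamma(R))$ is finite. (b) $R$ is a $\tau_z$-BFR if and only if $R$ is reduced and $\omega(\Gamma(R))$ is finite.
   Context: $U(R)$ is the group of units of $R$, $R^{\#}$ is the set of non-zero non-units, and $Z(R)$ is the set of zero-divisors (including $0$). The relations $\tau_z$ and $\tau_z^{\Delta}$ on $R^{\#}$ are $a\,\tau_z\,b\Leftrightarrow ab=0$ and $a\,\tau_z^{\Delta}\,b\Leftrightarrow (ab=0\text{ and }a\ne b)$. $\Gamma(R)$ is the simple graph with vertex set $Z(R)\setminus\{0\}$ in which distinct $a,b$ are adjacent iff $ab=0$. The clique number $\omega(\Gamma(R))$ is the largest integer $r\ge1$ such that $\Gamma(R)$ contains a complete subgraph $K^r$ on $r$ vertices ($\omega=0$ if $\Gamma(R)$ is empty); $\omega(\Gamma(R))=\infty$ if $K^r\subseteq\Gamma(R)$ for all $r\ge1$. For a symmetric relation $\tau$ on $R^{\#}$ and a non-unit $a$, a $\tau$-factorization of $a$ of length $n$ is an expression $a=\lambda a_1\cdots a_n$ with $n\ge 1$, $\lambda\in U(R)$, $a_i\in R^{\#}$ and $a_i\,\tau\,a_j$ for all $i\ne j$. The factorizations $a=\lambda(\lambda^{-1}a)$ (the case $n=1$) are called trivial. $0$ may not occur as a factor of a non-trivial $\tau$-factorization, but the trivial factorizations $0=\lambda 0$ are allowed. $R$ is a $\tau$-BFR if for every non-unit $a$ there is $N(a)\in\mathbb{N}$ such that every $\tau$-factorization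 of $a$ has length at most $N(a)$. *)

theory Defs
  imports "HOL-Algebra.Ring" "HOL-Library.Extended_Nat" "Graph_Theory.Kuratowski"
begin

definition nonunits :: "('a, 'b) ring_scheme \<Rightarrow> 'a set" where
  "nonunits R = carrier R - Units R"

definition nonzero_nonunits :: "('a, 'b) ring_scheme \<Rightarrow> 'a set" where
  "nonzero_nonunits R = nonunits R - {\<zero>\<^bsub>R\<^esub>}"

definition reduced_ring :: "('a, 'b) ring_scheme \<Rightarrow> bool" where
  "reduced_ring R \<longleftrightarrow> (\<forall>x\<in>carrier R. (\<exists>n::nat. x [^]\<^bsub>R\<^esub> n = \<zero>\<^bsub>R\<^esub>) \<longrightarrow> x = \<zero>\<^bsub>R\<^esub>)"

(* Zero is a member by convention, so also in the zero ring. *)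
definition zero_divisors :: "('a, 'b) ring_scheme \<Rightarrow> 'a set" where
  "zero_divisors R = insert \<zero>\<^bsub>R\<^esub>
     {a \<in> carrier R. \<exists>b\<in>carrier R. b \<noteq> \<zero>\<^bsub>R\<^esub> \<and> a \<otimes>\<^bsub>R\<^esub> b = \<zero>\<^bsub>R\<^esub>}"

(* An undirected edge is represented, as usual in Graph_Theory, by the two arcs joining its ends. *)
definition zero_divisor_graph :: "('a, 'b) ring_scheme \<Rightarrow> 'a pair_pre_digraph" where
  "zero_divisor_graph R =
     \<lparr>pverts = zero_divisors R - {\<zero>\<^bsub>R\<^esub>},
      parcs = {(a, b). a \<in> zero_divisors R - {\<zero>\<^bsub>R\<^esub>} \<and> b \<in> zero_divisors R - {\<zero>\<^bsub>R\<^esub>} \<and>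
                       a \<noteq> b \<and> a \<otimes>\<^bsub>R\<^esub> b = \<zero>\<^bsub>R\<^esub>}\<rparr>"

lemma zero_divisor_graph_simple:
  assumes "cring R"
  shows "pair_bidirected_digraph (zero_divisor_graph R)"
proof -
  interpret cring R by fact
  let ?G = "zero_divisor_graph R"
  have carr: "zero_divisors R \<subseteq> carrier R"
    by (auto simp: zero_divisors_def)
  have sym: "(b, a) \<in> parcs ?G" if "(a, b) \<in> parcs ?G" for a b
  proof -
    from that have "a \<otimes>\<^bsub>R\<^esub> b = b \<otimes>\<^bsub>R\<^esub> a"
      using carr by (intro m_comm) (auto simp: zero_divisor_graph_def)
    with that show ?thesis
      by (auto simp: zero_divisor_graph_def)
  qed
  show ?thesis
  proof
    fix e assume "e \<in> parcs ?G"
    then show "fst e \<in> pverts ?G" "snd e \<in> pverts ?G" "fst e \<noteq> snd e"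
      by (auto simp: zero_divisor_graph_def)
  next
    show "symmetric (with_proj ?G)"
      unfolding symmetric_def by (simp add: sym symI)
  qed
qed

definition contains_complete :: "('v, 'e) pre_digraph \<Rightarrow> nat \<Rightarrow> bool" where
  "contains_complete G r \<longleftrightarrow> (\<exists>H. subgraph H G \<and> complete_digraph r H)"

definition clique_number :: "('v, 'e) pre_digraph \<Rightarrow> enat" where
  "clique_number G =
     (if verts G = {} then 0
      else if \<forall>r\<ge>1. contains_complete G r then \<infinity>
      else enat (GREATEST r. r \<ge> 1 \<and> contains_complete G r))"

(* The factors are listed in as, with unit u in front.  The first alternative is the trivial
   factorization a = u (u^{-1} a); for nonzero a it is subsumed by the second one, so it only
   adds 0 = u 0. *)
definition tau_factorization ::
  "('a, 'b) ring_scheme \<Rightarrow> 'a rel \<Rightarrow> 'a \<Rightarrow> 'a \<Rightarrow> 'a list \<Rightarrow> bool" where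
  "tau_factorization R \<tau> a u as \<longleftrightarrow>
     a \<in> nonunits R \<and> u \<in> Units R \<and>
     (as = [inv\<^bsub>R\<^esub> u \<otimes>\<^bsub>R\<^esub> a] \<or>
      as \<noteq> [] \<and> set as \<subseteq> nonzero_nonunits R \<and>
      (\<forall>i<length as. \<forall>j<length as. i \<noteq> j \<longrightarrow> (as ! i, as ! j) \<in> \<tau>) \<and>
      a = u \<otimes>\<^bsub>R\<^esub> foldr (\<otimes>\<^bsub>R\<^esub>) as \<one>\<^bsub>R\<^esub>)"

definition tau_BFR :: "('a, 'b) ring_scheme \<Rightarrow> 'a rel \<Rightarrow> bool" where
  "tau_BFR R \<tau> \<longleftrightarrow>
     (\<forall>a\<in>nonunits R. \<exists>N::nat. \<forall>u as. tau_factorization R \<tau> a u as \<longrightarrow> length as \<le> N)"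

definition tau_z :: "('a, 'b) ring_scheme \<Rightarrow> 'a rel" where
  "tau_z R = {(a, b). a \<in> nonzero_nonunits R \<and> b \<in> nonzero_nonunits R \<and> a \<otimes>\<^bsub>R\<^esub> b = \<zero>\<^bsub>R\<^esub>}"

definition tau_z_Delta :: "('a, 'b) ring_scheme \<Rightarrow> 'a rel" where
  "tau_z_Delta R = {(a, b). a \<in> nonzero_nonunits R \<and> b \<in> nonzero_nonunits R \<and>
                            a \<otimes>\<^bsub>R\<^esub> b = \<zero>\<^bsub>R\<^esub> \<and> a \<noteq> b}"

end

(* The factors of a tau_z_Delta-factorization of length at least 2 are pairwise distinct and
   pairwise annihilating, so they form a clique of the zero-divisor graph; conversely, the vertices
   of a clique with at least two elements multiply to a factorization of 0.  Hence lengths are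
   bounded iff clique sizes are.  If R is reduced, no nonzero square vanishes, so the two relations
   coincide; if R is not reduced, some nonzero x has x^2 = 0 and then 0 = x ... x has
   tau_z-factorizations of every length. *)
theory Submission
  imports Defs
begin

section \<open>Cliques\<close>

text \<open>Vertex-set form of a complete subgraph, since factorizations supply only a set of
  vertices. Finiteness keeps \<open>card\<close> meaningful; an infinite complete set is seen
  through its finite subsets.\<close>

definition clique :: "'a pair_pre_digraph \<Rightarrow> 'a set \<Rightarrow> bool" where
  "clique G S \<longleftrightarrow>
     finite S \<and> S \<subseteq> pverts G \<and> (\<forall>a\<in>S. \<forall>b\<in>S. a \<noteq> b \<longrightarrow> (a, b) \<in> parcs G)"

lemma clique_subset: "clique G S \<Longrightarrow> T \<subseteq> S \<Longrightarrow> clique G T"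
  unfolding clique_def by (blast intro: finite_subset)

text \<open>Arcs of a subgraph persist in \<open>G\<close>, and conversely a clique together with
  all arcs between its distinct members is a complete subgraph. Well-formedness enters because
  \<open>subgraph\<close> demands it.\<close>

lemma contains_complete_iff_clique:
  assumes "wf_digraph (with_proj G)"
  shows "contains_complete (with_proj G) r \<longleftrightarrow> (\<exists>S. clique G S \<and> card S = r)"
proof
  assume "contains_complete (with_proj G) r"
  then obtain H where sub: "subgraph H (with_proj G)" and K: "complete_digraph r H"
    unfolding contains_complete_def by blast
  interpret H: graph H
    using K by (simp add: complete_digraph_def)
  have "arcs_ends H \<subseteq> parcs G"
    using arcs_ends_mono[OF sub] by simp
  with sub K have "clique G (verts H)"
    unfolding clique_def complete_digraph_def subgraph_def by auto
  with K show "\<exists>S. clique G S \<and> card S = r"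
    unfolding complete_digraph_def by blast
next
  assume "\<exists>S. clique G S \<and> card S = r"
  then obtain S where S: "clique G S" "card S = r"
    by blast
  let ?H = "\<lparr>pverts = S, parcs = {(u, v). (u, v) \<in> S \<times> S \<and> u \<noteq> v}\<rparr>"
  have K: "complete_digraph r (with_proj ?H)"
    using S by (simp add: complete_digraph_pair_def clique_def)
  have "wf_digraph (with_proj ?H)"
    by unfold_locales auto
  with S assms have "subgraph (with_proj ?H) (with_proj G)"
    by (auto simp: subgraph_def clique_def compatible_def)
  with K show "contains_complete (with_proj G) r"
    unfolding contains_complete_def by blast
qed

text \<open>Finiteness is decided by which branch of \<open>clique_number\<close> applies. Cliques
  are closed under subsets, so one missing size bounds all sizes.\<close>

lemma clique_number_finite_iff:
  assumes wf: "wf_digraph (with_proj G)"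
  shows "clique_number (with_proj G) < \<infinity> \<longleftrightarrow> (\<exists>N. \<forall>S. clique G S \<longrightarrow> card S \<le> N)"
proof
  assume fin: "clique_number (with_proj G) < \<infinity>"
  show "\<exists>N. \<forall>S. clique G S \<longrightarrow> card S \<le> N"
  proof (cases "pverts G = {}")
    case True
    then show ?thesis
      by (auto simp: clique_def)
  next
    case False
    with fin obtain r where r: "\<not> contains_complete (with_proj G) r"
      by (auto simp: clique_number_def split: if_splits)
    have "card S \<le> r" if "clique G S" for S
    proof (rule ccontr)
      assume "\<not> card S \<le> r"
      then obtain T where "T \<subseteq> S" "card T = r"
        using obtain_subset_with_card_n[of r S] by auto
      with that r show False
        unfolding contains_complete_iff_clique[OF wf] by (blast intro: clique_subset)
    qed
    then show ?thesis
      by blast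
  qed
next
  assume "\<exists>N. \<forall>S. clique G S \<longrightarrow> card S \<le> N"
  then obtain N where "\<And>S. clique G S \<Longrightarrow> card S \<le> N"
    by blast
  then have "\<not> contains_complete (with_proj G) (Suc N)"
    unfolding contains_complete_iff_clique[OF wf] by (metis not_less_eq_eq order_refl)
  \<comment> \<open>\<open>Suc N\<close> is at least 1, so it refutes the condition of the infinite
    branch.\<close>
  then have "\<not> (\<forall>r\<ge>1. contains_complete (with_proj G) r)"
    by (metis One_nat_def Suc_le_mono zero_le)
  then show "clique_number (with_proj G) < \<infinity>"
    unfolding clique_number_def by (simp only: if_False) (simp add: zero_enat_def)
qed


section \<open>Factorizations\<close>

context cring
begin

lemma wf_zero_divisor_graph: "wf_digraph (with_proj (zero_divisor_graph R))"
  by unfold_locales (auto simp: zero_divisor_graph_def)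

text \<open>Cancelling a unit \<open>a\<close> in \<open>a \<otimes> b = \<zero>\<close> would give
  \<open>b = \<zero>\<close>. Hence vertices of the graph are admissible factors.\<close>

lemma zero_divisors_subset_nonunits:
  "zero_divisors R - {\<zero>} \<subseteq> nonzero_nonunits R"
proof
  fix a
  assume "a \<in> zero_divisors R - {\<zero>}"
  then obtain b where ab: "a \<in> carrier R" "a \<noteq> \<zero>" "b \<in> carrier R" "b \<noteq> \<zero>" "a \<otimes> b = \<zero>"
    by (auto simp: zero_divisors_def)
  have "a \<notin> Units R"
  proof
    assume "a \<in> Units R"
    moreover have "a \<otimes> b = a \<otimes> \<zero>"
      using ab by simp
    ultimately show False
      using ab Units_l_cancel by blast
  qed
  with ab show "a \<in> nonzero_nonunits R"
    by (simp add: nonzero_nonunits_def nonunits_def)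
qed

text \<open>If zero is invertible, then one equals zero and the ring is trivial.\<close>

lemma zero_nonunit:
  assumes "x \<in> carrier R" "x \<noteq> \<zero>"
  shows "\<zero> \<in> nonunits R"
  using assms by (metis DiffI Units_l_inv_ex l_null nonunits_def r_null r_one zero_closed)

lemma foldr_mult_closed: "set as \<subseteq> carrier R \<Longrightarrow> foldr (\<otimes>) as \<one> \<in> carrier R"
  by (induction as) auto

text \<open>The first two factors already make the product vanish, whatever follows. Keeping
  \<open>\<tau>\<close> arbitrary serves both relations.\<close>

lemma zero_factorizationI:
  assumes "x \<in> nonzero_nonunits R" "y \<in> nonzero_nonunits R" "x \<otimes> y = \<zero>"
    and "set as \<subseteq> nonzero_nonunits R"
    and "\<And>i j. i < length (x # y # as) \<Longrightarrow> j < length (x # y # as) \<Longrightarrow> i \<noteq> j \<Longrightarrow>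
           ((x # y # as) ! i, (x # y # as) ! j) \<in> \<tau>"
  shows "tau_factorization R \<tau> \<zero> \<one> (x # y # as)"
proof -
  have carr: "nonzero_nonunits R \<subseteq> carrier R"
    by (auto simp: nonzero_nonunits_def nonunits_def)
  with assms have mem: "x \<in> carrier R" "y \<in> carrier R" "foldr (\<otimes>) as \<one> \<in> carrier R"
    by (blast intro: foldr_mult_closed)+
  then have "foldr (\<otimes>) (x # y # as) \<one> = (x \<otimes> y) \<otimes> foldr (\<otimes>) as \<one>"
    by (simp add: m_assoc)
  also have "\<dots> = \<zero>"
    using assms mem by simp
  finally have "foldr (\<otimes>) (x # y # as) \<one> = \<zero>" .
  moreover have "\<zero> \<in> nonunits R"
    using assms mem zero_nonunit[of x] by (auto simp: nonzero_nonunits_def)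
  ultimately show ?thesis
    unfolding tau_factorization_def using assms by auto
qed

section \<open>Correspondence between factorizations and cliques\<close>

lemma tau_z_Delta_factorization_clique:
  assumes "tau_factorization R (tau_z_Delta R) a u as" "2 \<le> length as"
  shows "clique (zero_divisor_graph R) (set as)" "card (set as) = length as"
proof -
  have rel: "(as ! i, as ! j) \<in> tau_z_Delta R" if "i < length as" "j < length as" "i \<noteq> j" for i j
    using assms that unfolding tau_factorization_def by auto
  \<comment> \<open>\<open>tau_z_Delta\<close> is irreflexive, so no factor can repeat.\<close>
  have "distinct as"
    unfolding distinct_conv_nth
  proof (intro allI impI)
    show "as ! i \<noteq> as ! j" if "i < length as" "j < length as" "i \<noteq> j" for i j
      using rel[OF that] by (simp add: tau_z_Delta_def)
  qed
  then show "card (set as) = length as"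
    by (rule distinct_card)
  have arc: "(x, y) \<in> tau_z_Delta R" if "x \<in> set as" "y \<in> set as" "x \<noteq> y" for x y
  proof -
    obtain i j where "i < length as" "x = as ! i" "j < length as" "y = as ! j"
      using \<open>x \<in> set as\<close> \<open>y \<in> set as\<close> by (auto simp: in_set_conv_nth)
    then show ?thesis
      using rel[of i j] \<open>x \<noteq> y\<close> by blast
  qed
  have zd: "x \<in> zero_divisors R - {\<zero>}" if "x \<in> set as" for x
  proof -
    obtain i where i: "i < length as" "x = as ! i"
      using \<open>x \<in> set as\<close> by (metis in_set_conv_nth)
    \<comment> \<open>Any index other than \<open>i\<close> will do, and length at least 2 provides
      one: the factor there is nonzero and annihilates \<open>x\<close>.\<close>
    define j where "j = (if i = 0 then 1 else 0 :: nat)"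
    have "j < length as" "i \<noteq> j"
      using assms(2) by (auto simp: j_def)
    with i have "(x, as ! j) \<in> tau_z_Delta R"
      using rel by blast
    then show ?thesis
      by (auto simp: tau_z_Delta_def zero_divisors_def nonzero_nonunits_def nonunits_def)
  qed
  show "clique (zero_divisor_graph R) (set as)"
    unfolding clique_def
  proof (intro conjI ballI impI)
    fix x y
    assume "x \<in> set as" "y \<in> set as" "x \<noteq> y"
    with zd[of x] zd[of y] arc[of x y] show "(x, y) \<in> parcs (zero_divisor_graph R)"
      by (simp add: zero_divisor_graph_def tau_z_Delta_def)
  qed (use zd in \<open>auto simp: zero_divisor_graph_def\<close>)
qed

text \<open>List the clique without repetition. Two members are required for the product to
  vanish.\<close>

lemma clique_imp_tau_z_Delta_factorization:
  assumes "clique (zero_divisor_graph R) S" "2 \<le> card S"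
  shows "\<exists>as. tau_factorization R (tau_z_Delta R) \<zero> \<one> as \<and> length as = card S"
proof -
  have "finite S"
    using assms by (simp add: clique_def)
  then obtain as where as: "set as = S" "distinct as"
    using finite_distinct_list by blast
  then have len: "length as = card S"
    using distinct_card by metis
  with assms obtain x y bs where xy: "as = x # y # bs"
    by (metis One_nat_def Suc_1 Suc_le_length_iff)
  have "S \<subseteq> zero_divisors R - {\<zero>}"
    using assms by (simp add: clique_def zero_divisor_graph_def)
  then have S: "S \<subseteq> nonzero_nonunits R"
    using zero_divisors_subset_nonunits by blast
  have arc: "(a, b) \<in> tau_z_Delta R" if "a \<in> S" "b \<in> S" "a \<noteq> b" for a b
    using that S assms by (auto simp: clique_def zero_divisor_graph_def tau_z_Delta_def)
  have "tau_factorization R (tau_z_Delta R) \<zero> \<one> (x # y # bs)"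
  proof (rule zero_factorizationI)
    show "x \<in> nonzero_nonunits R" "y \<in> nonzero_nonunits R" "set bs \<subseteq> nonzero_nonunits R"
      using S as xy by auto
    have "(x, y) \<in> tau_z_Delta R"
      using as xy by (intro arc) auto
    then show "x \<otimes> y = \<zero>"
      by (simp add: tau_z_Delta_def)
    show "((x # y # bs) ! i, (x # y # bs) ! j) \<in> tau_z_Delta R"
      if "i < length (x # y # bs)" "j < length (x # y # bs)" "i \<noteq> j" for i j
      \<comment> \<open>Distinctness of \<open>as\<close> turns different positions into different,
        hence adjacent, vertices.\<close>
      using that as unfolding xy[symmetric] by (intro arc) (auto simp: nth_eq_iff_index_eq)
  qed
  with len xy show ?thesis
    by blast
qed

lemma tau_z_Delta_BFR_iff:
  "tau_BFR R (tau_z_Delta R) \<longleftrightarrow> clique_number (with_proj (zero_divisor_graph R)) < \<infinity>"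
  unfolding clique_number_finite_iff[OF wf_zero_divisor_graph]
proof
  assume bfr: "tau_BFR R (tau_z_Delta R)"
  show "\<exists>N. \<forall>S. clique (zero_divisor_graph R) S \<longrightarrow> card S \<le> N"
  proof (cases "\<zero> \<in> nonunits R")
    case True
    with bfr obtain N where
      N: "\<And>u as. tau_factorization R (tau_z_Delta R) \<zero> u as \<Longrightarrow> length as \<le> N"
      unfolding tau_BFR_def by blast
    \<comment> \<open>Only cliques with at least two members yield a factorization of zero; the 1
      covers the smaller ones.\<close>
    have "card S \<le> max 1 N" if "clique (zero_divisor_graph R) S" for S
    proof (cases "2 \<le> card S")
      case True
      with that show ?thesis
        by (metis N clique_imp_tau_z_Delta_factorization max.coboundedI2)
    qed simp
    then show ?thesis
      by blast
  next
    case False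
    \<comment> \<open>Zero is a unit here, so the ring is trivial and the graph empty.\<close>
    then have "zero_divisors R - {\<zero>} = {}"
      using zero_nonunit by (auto simp: zero_divisors_def)
    then have "card S \<le> 0" if "clique (zero_divisor_graph R) S" for S
      using that by (auto simp: clique_def zero_divisor_graph_def)
    then show ?thesis
      by blast
  qed
next
  assume "\<exists>N. \<forall>S. clique (zero_divisor_graph R) S \<longrightarrow> card S \<le> N"
  then obtain N where N: "\<And>S. clique (zero_divisor_graph R) S \<Longrightarrow> card S \<le> N"
    by blast
  \<comment> \<open>One bound serves every \<open>a\<close>; the 1 covers factorizations with a
    single factor, which need not come from a clique.\<close>
  have "length as \<le> max 1 N" if "tau_factorization R (tau_z_Delta R) a u as" for a u as
  proof (cases "2 \<le> length as")
    case True
    with that show ?thesis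
      by (metis N tau_z_Delta_factorization_clique max.coboundedI2)
  qed simp
  then show "tau_BFR R (tau_z_Delta R)"
    unfolding tau_BFR_def by blast
qed

section \<open>Reduced rings and vanishing squares\<close>

lemma reduced_ring_iff_square:
  "reduced_ring R \<longleftrightarrow> (\<forall>x\<in>carrier R. x \<otimes> x = \<zero> \<longrightarrow> x = \<zero>)"
proof
  assume red: "reduced_ring R"
  show "\<forall>x\<in>carrier R. x \<otimes> x = \<zero> \<longrightarrow> x = \<zero>"
  proof (intro ballI impI)
    fix x
    assume "x \<in> carrier R" "x \<otimes> x = \<zero>"
    then have "x [^] (2::nat) = \<zero>"
      by (simp add: numeral_2_eq_2)
    with red \<open>x \<in> carrier R\<close> show "x = \<zero>"
      unfolding reduced_ring_def by blast
  qed
next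
  assume sq: "\<forall>x\<in>carrier R. x \<otimes> x = \<zero> \<longrightarrow> x = \<zero>"
  have "x = \<zero>" if x: "x \<in> carrier R" and "x [^] n = \<zero>" for x and n :: nat
    using that(2)
  proof (induction n)
    \<comment> \<open>Here one equals zero, so \<open>x\<close> is zero too.\<close>
    case 0
    with x show ?case
      by (metis l_one l_null nat_pow_0)
  next
    case (Suc n)
    show ?case
    proof (cases n)
      case 0
      with Suc.prems x show ?thesis
        by simp
    next
      \<comment> \<open>As \<open>2n = (n + 1) + m\<close>, the square of \<open>x [^] n\<close>
        contains the vanishing power \<open>x [^] Suc n\<close>. The hypothesis on squares then
        lowers the exponent to \<open>n\<close>.\<close>
      case (Suc m)
      have "x [^] n \<otimes> x [^] n = x [^] (n + n)"
        using x by (rule nat_pow_mult)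
      also have "n + n = Suc n + m"
        using Suc by simp
      also have "x [^] (Suc n + m) = \<zero>"
        using nat_pow_mult[OF x, of "Suc n" m] Suc.prems x by simp
      finally show ?thesis
        using sq x Suc.IH nat_pow_closed by blast
    qed
  qed
  then show "reduced_ring R"
    unfolding reduced_ring_def by blast
qed

lemma reduced_imp_tau_z_eq: "reduced_ring R \<Longrightarrow> tau_z R = tau_z_Delta R"
  unfolding reduced_ring_iff_square
  by (auto simp: tau_z_def tau_z_Delta_def nonzero_nonunits_def nonunits_def)

lemma tau_z_BFR_imp_reduced:
  assumes bfr: "tau_BFR R (tau_z R)"
  shows "reduced_ring R"
  unfolding reduced_ring_iff_square
proof (intro ballI impI, rule ccontr)
  fix x
  assume x: "x \<in> carrier R" "x \<otimes> x = \<zero>" "x \<noteq> \<zero>"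
  then have xn: "x \<in> nonzero_nonunits R"
    using zero_divisors_subset_nonunits by (auto simp: zero_divisors_def)
  \<comment> \<open>\<open>tau_z\<close> relates \<open>x\<close> to itself, so copies of
    \<open>x\<close> give length \<open>n + 2\<close>; taking \<open>n = N\<close> exceeds any
    proposed bound \<open>N\<close>.\<close>
  have "tau_factorization R (tau_z R) \<zero> \<one> (x # x # replicate n x)" for n
  proof (rule zero_factorizationI)
    have eq: "x # x # replicate n x = replicate (Suc (Suc n)) x"
      by simp
    show "((x # x # replicate n x) ! i, (x # x # replicate n x) ! j) \<in> tau_z R"
      if "i < length (x # x # replicate n x)" "j < length (x # x # replicate n x)" for i j
      using that x xn unfolding eq by (simp add: tau_z_def del: replicate_Suc)
  qed (use x xn in auto)
  moreover obtain N where "\<And>u as. tau_factorization R (tau_z R) \<zero> u as \<Longrightarrow> length as \<le> N"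
    using bfr x zero_nonunit unfolding tau_BFR_def by blast
  ultimately have "length (x # x # replicate N x) \<le> N"
    by blast
  then show False
    by simp
qed

end

theorem theorem5p8:
  fixes R :: "('a, 'b) ring_scheme"
  assumes "cring R"
  shows "(tau_BFR R (tau_z_Delta R) \<longleftrightarrow> clique_number (with_proj (zero_divisor_graph R)) < \<infinity>) \<and>
         (tau_BFR R (tau_z R) \<longleftrightarrow>
            reduced_ring R \<and> clique_number (with_proj (zero_divisor_graph R)) < \<infinity>)"
proof -
  interpret cring R by fact
  have "tau_BFR R (tau_z R) \<longleftrightarrow> reduced_ring R \<and> tau_BFR R (tau_z_Delta R)"
    by (metis reduced_imp_tau_z_eq tau_z_BFR_imp_reduced)
  then show ?thesis
    using tau_z_Delta_BFR_iff by simp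
qed

end
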